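(* Let $\mathcal H$ be a CNP space on a set $X$ with kernel $k$, let $T$ be a closed, densely defined operator in $\mathcal H$ affiliated to $\mathrm{Mult}(\mathcal H)$, with symbol $h$ (so that $Tf=hf$ for all $f\in\mathrm{Dom}\,T$), and let $A,B$ be the Beurling pair for $h$. Equip $\mathrm{Dom}\,T$ and $\mathrm{Dom}\,T^*$ with their graph norms. Then $\mathrm{Dom}\,T$ and $\mathrm{Dom}\,T^*$ are reproducing kernel Hilbert spaces on $X$ whose reproducing kernels are given by $$k^T(x,y)=A(x)A(y)^*k(x,y)\quad\text{and}\quad k^{T^*}(x,y)=(1-B(x)B(y)^* )k(x,y)$$ respectively.
   Context: A CNP kernel on a set $X$ is a kernel of the form $k(x,y)=\frac{1}{1-\langle u(x),u(y)\rangle}$ where $u:X\to \ell^2(I)$ is injective and $\|u(x)\|<1$ for all $x$. A CNP space on $X$ is the reproducing kernel Hilbert space $\mathcal H$ on $X$ with such a kernel. $\mathrm{Mult}(\mathcal H)$ is the algebra of functions $\varphi:X\to\mathbb C$ with $\varphi\mathcal H\subset\mathcal H$. A densely defined operator $T$ in $\mathcal H$ is affiliated to $\mathrm{Mult}(\mathcal H)$ if for all $f\in\mathrm{Dom}\,T$ and $\varphi\in\mathrm{Mult}(\mathcal H)$ one has $\varphi f\in\mathrm{Dom}\,T$ and $T(\varphi f)=\varphi\cdot(Tf)$. For such $T$ there is a function $h:X\to\mathbb C$, the symbol of $T$, with $Tf=hf$ for all $f\in\mathrm{Dom}\,T$. Graph norms: $\|f\|_{\mathrm{Dom}\,T}^2=\|f\|_{\mathcal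 H}^2+\|Tf\|_{\mathcal H}^2$, and $\|f\|_{\mathrm{Dom}\,T^*}^2=\|f\|_{\mathcal H}^2+\|T^*f\|_{\mathcal H}^2$. The graph of $T$ is $G(T)=\{(f,Tf):f\in\mathrm{Dom}\,T\}\subset\mathcal H\oplus\mathcal H$. For a Hilbert space $\mathcal E$, $\mathcal H\otimes\mathcal E$ is identified with the $\mathcal E$-valued reproducing kernel Hilbert space on $X$ with kernel $k(x,y)I_{\mathcal E}$. A row multiplier is a function $A:X\to\mathcal B(\mathcal E,\mathbb C)$ such that $(AF)(x)=A(x)F(x)$ defines a bounded operator $M_A:\mathcal H\otimes\mathcal E\to\mathcal H$. A Beurling pair for $T$ (equivalently for $h$) is a pair of row multipliers $A,B$, for some auxiliary Hilbert space $\mathcal E$, such that the operator $F\mapsto(AF,BF)$ from $\mathcal H\otimes\mathcal E$ to $\mathcal H\oplus\mathcal H$ is a partial isometry with range exactly $G(T)$. Such a pair always exists (McCullough–Trent), and one choice is fixed. *)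

theory Defs
  imports "HOL-Analysis.Analysis" "HOL-Library.Function_Algebras"
begin

section \<open>Complex vector spaces\<close>

class complex_vector = ab_group_add +
  fixes scaleC :: "complex \<Rightarrow> 'a \<Rightarrow> 'a"  (infixr "*\<^sub>C" 75)
  assumes scaleC_add_right: "a *\<^sub>C (x + y) = a *\<^sub>C x + a *\<^sub>C y"
    and scaleC_add_left: "(a + b) *\<^sub>C x = a *\<^sub>C x + b *\<^sub>C x"
    and scaleC_scaleC: "a *\<^sub>C b *\<^sub>C x = (a * b) *\<^sub>C x"
    and scaleC_one: "1 *\<^sub>C x = x"

instantiation complex :: complex_vector
begin
definition scaleC_complex :: "complex \<Rightarrow> complex \<Rightarrow> complex"
  where "scaleC_complex c z = c * z"
instance by standard (simp_all add: scaleC_complex_def algebra_simps)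
end

instantiation "fun" :: (type, complex_vector) complex_vector
begin
definition scaleC_fun :: "complex \<Rightarrow> ('a \<Rightarrow> 'b) \<Rightarrow> 'a \<Rightarrow> 'b"
  where "scaleC_fun c f = (\<lambda>x. c *\<^sub>C f x)"
instance
  by standard (simp_all add: scaleC_fun_def fun_eq_iff
      scaleC_add_right scaleC_add_left scaleC_scaleC scaleC_one)
end

instantiation prod :: (complex_vector, complex_vector) complex_vector
begin
definition scaleC_prod :: "complex \<Rightarrow> 'a \<times> 'b \<Rightarrow> 'a \<times> 'b"
  where "scaleC_prod c p = (c *\<^sub>C fst p, c *\<^sub>C snd p)"
instance
  by standard (simp_all add: scaleC_prod_def prod_eq_iff
      scaleC_add_right scaleC_add_left scaleC_scaleC scaleC_one)
end

lemma vector_space_scaleC: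
  "vector_space (scaleC :: complex \<Rightarrow> 'a \<Rightarrow> 'a::complex_vector)"
  by unfold_locales (simp_all add: scaleC_add_right scaleC_add_left scaleC_scaleC scaleC_one)

section \<open>Hilbert spaces\<close>

text \<open>A Hilbert space is a set of vectors inside an ambient complex vector space (such as the
  space of all functions on a set) together with an inner product, linear in its first argument.
  Values of the inner product outside the set are irrelevant.\<close>

record 'v ip_space =
  vecs :: "'v set"
  ip :: "'v \<Rightarrow> 'v \<Rightarrow> complex"

definition nrm :: "'v ip_space \<Rightarrow> 'v \<Rightarrow> real" where
  "nrm V v = sqrt (Re (ip V v v))"

text \<open>The library's metric space locale wants a nonnegative symmetric distance on the whole
  type, hence the arbitrary value 0 off the space.\<close>

definition hdist :: "'v::complex_vector ip_space \<Rightarrow> 'v \<Rightarrow> 'v \<Rightarrow> real" where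
  "hdist V v w = (if v \<in> vecs V \<and> w \<in> vecs V then nrm V (v - w) else 0)"

definition norm_topology :: "'v::complex_vector ip_space \<Rightarrow> 'v topology" where
  "norm_topology V = Metric_space.mtopology (vecs V) (hdist V)"

definition hilbert_space :: "'v::complex_vector ip_space \<Rightarrow> bool" where
  "hilbert_space V \<longleftrightarrow>
     module.subspace scaleC (vecs V) \<and>
     (\<forall>f\<in>vecs V. \<forall>g\<in>vecs V. \<forall>w\<in>vecs V. ip V (f + g) w = ip V f w + ip V g w) \<and>
     (\<forall>c. \<forall>f\<in>vecs V. \<forall>w\<in>vecs V. ip V (c *\<^sub>C f) w = c * ip V f w) \<and>
     (\<forall>f\<in>vecs V. \<forall>g\<in>vecs V. ip V g f = cnj (ip V f g)) \<and>
     (\<forall>f\<in>vecs V. f \<noteq> 0 \<longrightarrow> Re (ip V f f) > 0) \<and>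
     Metric_space.mcomplete (vecs V) (hdist V)"

definition complex_line :: "complex ip_space" where
  "complex_line = \<lparr>vecs = UNIV, ip = (\<lambda>z w. z * cnj w)\<rparr>"

definition ell2 :: "('i \<Rightarrow> complex) ip_space" where
  "ell2 = \<lparr>vecs = {a. (\<lambda>i. (cmod (a i))\<^sup>2) summable_on UNIV},
           ip = (\<lambda>a b. \<Sum>\<^sub>\<infinity>i. a i * cnj (b i))\<rparr>"

definition direct_sum :: "'v ip_space \<Rightarrow> 'w ip_space \<Rightarrow> ('v \<times> 'w) ip_space" where
  "direct_sum V W = \<lparr>vecs = vecs V \<times> vecs W,
                     ip = (\<lambda>p q. ip V (fst p) (fst q) + ip W (snd p) (snd q))\<rparr>"

section \<open>Operators\<close>

text \<open>Values of \<open>app\<close> outside \<open>dom_of\<close> are irrelevant.\<close>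

record ('v, 'w) operator =
  dom_of :: "'v set"
  app :: "'v \<Rightarrow> 'w"

definition everywhere :: "'v ip_space \<Rightarrow> ('v \<Rightarrow> 'w) \<Rightarrow> ('v, 'w) operator" where
  "everywhere V L = \<lparr>dom_of = vecs V, app = L\<rparr>"

definition linear_operator ::
  "'v::complex_vector ip_space \<Rightarrow> 'w::complex_vector ip_space \<Rightarrow> ('v, 'w) operator \<Rightarrow> bool" where
  "linear_operator V W T \<longleftrightarrow>
     module.subspace scaleC (dom_of T) \<and> dom_of T \<subseteq> vecs V \<and> app T ` dom_of T \<subseteq> vecs W \<and>
     (\<forall>f\<in>dom_of T. \<forall>g\<in>dom_of T. app T (f + g) = app T f + app T g) \<and>
     (\<forall>c. \<forall>f\<in>dom_of T. app T (c *\<^sub>C f) = c *\<^sub>C app T f)"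

definition bounded_operator ::
  "'v::complex_vector ip_space \<Rightarrow> 'w::complex_vector ip_space \<Rightarrow> ('v \<Rightarrow> 'w) \<Rightarrow> bool" where
  "bounded_operator V W L \<longleftrightarrow>
     linear_operator V W (everywhere V L) \<and> (\<exists>C. \<forall>v\<in>vecs V. nrm W (L v) \<le> C * nrm V v)"

definition graph :: "('v, 'w) operator \<Rightarrow> ('v \<times> 'w) set" where
  "graph T = {(f, app T f) | f. f \<in> dom_of T}"

definition densely_defined :: "'v::complex_vector ip_space \<Rightarrow> ('v, 'w) operator \<Rightarrow> bool" where
  "densely_defined V T \<longleftrightarrow> norm_topology V closure_of dom_of T = vecs V"

definition closed_operator ::
  "'v::complex_vector ip_space \<Rightarrow> 'w::complex_vector ip_space \<Rightarrow> ('v, 'w) operator \<Rightarrow> bool" where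
  "closed_operator V W T \<longleftrightarrow> closedin (norm_topology (direct_sum V W)) (graph T)"

definition adjoint_op ::
  "'v ip_space \<Rightarrow> 'w ip_space \<Rightarrow> ('v, 'w) operator \<Rightarrow> ('w, 'v) operator" where
  "adjoint_op V W T =
     \<lparr>dom_of = {g \<in> vecs W. \<exists>w\<in>vecs V. \<forall>f\<in>dom_of T. ip W (app T f) g = ip V f w},
      app = (\<lambda>g. THE w. w \<in> vecs V \<and> (\<forall>f\<in>dom_of T. ip W (app T f) g = ip V f w))\<rparr>"

definition partial_isometry ::
  "'v::complex_vector ip_space \<Rightarrow> 'w::complex_vector ip_space \<Rightarrow> ('v \<Rightarrow> 'w) \<Rightarrow> bool" where
  "partial_isometry V W L \<longleftrightarrow>
     bounded_operator V W L \<and>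
     (\<forall>v\<in>vecs V. (\<forall>z\<in>vecs V. L z = 0 \<longrightarrow> ip V v z = 0) \<longrightarrow> nrm W (L v) = nrm V v)"

text \<open>The domain of an operator in \<open>V\<close> with the inner product inducing its graph norm
  \<open>\<parallel>f\<parallel>\<^sup>2 + \<parallel>T f\<parallel>\<^sup>2\<close>.\<close>

definition graph_space :: "'v ip_space \<Rightarrow> ('v, 'v) operator \<Rightarrow> 'v ip_space" where
  "graph_space V T = \<lparr>vecs = dom_of T, ip = (\<lambda>f g. ip V f g + ip V (app T f) (app T g))\<rparr>"

section \<open>Reproducing kernel Hilbert spaces\<close>

definition rkhs :: "('x \<Rightarrow> complex) ip_space \<Rightarrow> bool" where
  "rkhs H \<longleftrightarrow> hilbert_space H \<and> (\<forall>x. bounded_operator H complex_line (\<lambda>f. f x))"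

definition reproducing_kernel ::
  "('x \<Rightarrow> complex) ip_space \<Rightarrow> ('x \<Rightarrow> 'x \<Rightarrow> complex) \<Rightarrow> bool" where
  "reproducing_kernel H k \<longleftrightarrow>
     (\<forall>y. (\<lambda>x. k x y) \<in> vecs H \<and> (\<forall>f\<in>vecs H. ip H f (\<lambda>x. k x y) = f y))"

definition cnp_kernel ::
  "('x \<Rightarrow> 'i \<Rightarrow> complex) \<Rightarrow> ('x \<Rightarrow> 'x \<Rightarrow> complex) \<Rightarrow> bool" where
  "cnp_kernel u k \<longleftrightarrow>
     inj u \<and> (\<forall>x. u x \<in> vecs ell2 \<and> nrm ell2 (u x) < 1) \<and>
     (\<forall>x y. k x y = 1 / (1 - ip ell2 (u x) (u y)))"

definition cnp_space ::
  "('x \<Rightarrow> 'i \<Rightarrow> complex) \<Rightarrow> ('x \<Rightarrow> 'x \<Rightarrow> complex) \<Rightarrow> ('x \<Rightarrow> complex) ip_space \<Rightarrow> bool" where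
  "cnp_space u k H \<longleftrightarrow> cnp_kernel u k \<and> rkhs H \<and> reproducing_kernel H k"

text \<open>\<open>HE\<close> is the \<open>E\<close>-valued reproducing kernel Hilbert space with kernel \<open>k(x,y) I\<^sub>E\<close>; this
  determines \<open>HE\<close>, and it is the Hilbert space tensor product of the space of \<open>k\<close> with \<open>E\<close>.\<close>

definition tensor_rkhs ::
  "('x \<Rightarrow> 'x \<Rightarrow> complex) \<Rightarrow> 'e::complex_vector ip_space \<Rightarrow> ('x \<Rightarrow> 'e) ip_space \<Rightarrow> bool" where
  "tensor_rkhs k E HE \<longleftrightarrow>
     hilbert_space HE \<and>
     (\<forall>x. bounded_operator HE E (\<lambda>F. F x)) \<and>
     (\<forall>y. \<forall>e\<in>vecs E. (\<lambda>x. k x y *\<^sub>C e) \<in> vecs HE \<and>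
        (\<forall>F\<in>vecs HE. ip HE F (\<lambda>x. k x y *\<^sub>C e) = ip E (F y) e))"

section \<open>Multipliers and affiliated operators\<close>

definition Mult :: "('x \<Rightarrow> complex) ip_space \<Rightarrow> ('x \<Rightarrow> complex) set" where
  "Mult H = {\<phi>. \<forall>f\<in>vecs H. (\<lambda>x. \<phi> x * f x) \<in> vecs H}"

definition affiliated ::
  "('x \<Rightarrow> complex) ip_space \<Rightarrow> ('x \<Rightarrow> complex, 'x \<Rightarrow> complex) operator \<Rightarrow> bool" where
  "affiliated H T \<longleftrightarrow>
     linear_operator H H T \<and> densely_defined H T \<and>
     (\<forall>f\<in>dom_of T. \<forall>\<phi>\<in>Mult H.
        (\<lambda>x. \<phi> x * f x) \<in> dom_of T \<and> app T (\<lambda>x. \<phi> x * f x) = (\<lambda>x. \<phi> x * app T f x))"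

definition symbol_of ::
  "('x \<Rightarrow> complex, 'x \<Rightarrow> complex) operator \<Rightarrow> ('x \<Rightarrow> complex) \<Rightarrow> bool" where
  "symbol_of T h \<longleftrightarrow> (\<forall>f\<in>dom_of T. app T f = (\<lambda>x. h x * f x))"

definition row_mult_op :: "('x \<Rightarrow> 'e \<Rightarrow> complex) \<Rightarrow> ('x \<Rightarrow> 'e) \<Rightarrow> 'x \<Rightarrow> complex" where
  "row_mult_op A F = (\<lambda>x. A x (F x))"

definition row_multiplier ::
  "('x \<Rightarrow> complex) ip_space \<Rightarrow> 'e::complex_vector ip_space \<Rightarrow> ('x \<Rightarrow> 'e) ip_space \<Rightarrow>
   ('x \<Rightarrow> 'e \<Rightarrow> complex) \<Rightarrow> bool" where
  "row_multiplier H E HE A \<longleftrightarrow>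
     (\<forall>x. bounded_operator E complex_line (A x)) \<and> bounded_operator HE H (row_mult_op A)"

definition beurling_pair ::
  "('x \<Rightarrow> complex) ip_space \<Rightarrow> 'e::complex_vector ip_space \<Rightarrow> ('x \<Rightarrow> 'e) ip_space \<Rightarrow>
   ('x \<Rightarrow> complex, 'x \<Rightarrow> complex) operator \<Rightarrow>
   ('x \<Rightarrow> 'e \<Rightarrow> complex) \<Rightarrow> ('x \<Rightarrow> 'e \<Rightarrow> complex) \<Rightarrow> bool" where
  "beurling_pair H E HE T A B \<longleftrightarrow>
     row_multiplier H E HE A \<and> row_multiplier H E HE B \<and>
     partial_isometry HE (direct_sum H H) (\<lambda>F. (row_mult_op A F, row_mult_op B F)) \<and>
     (\<lambda>F. (row_mult_op A F, row_mult_op B F)) ` vecs HE = graph T"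

text \<open>The operator \<open>a b\<^sup>*\<close> on the complex line, for functionals \<open>a\<close>, \<open>b\<close> on \<open>E\<close>, identified
  with the scalar by which it acts, that is, with its value at \<open>1\<close>.\<close>

definition comp_adjoint :: "'e ip_space \<Rightarrow> ('e \<Rightarrow> complex) \<Rightarrow> ('e \<Rightarrow> complex) \<Rightarrow> complex" where
  "comp_adjoint E a b = a (app (adjoint_op E complex_line (everywhere E b)) 1)"

end

theory Submission
  imports Defs
begin

text \<open>The partial isometry \<open>L F = (A F, B F)\<close> preserves the inner product of \<open>F\<close> with any vector
  when \<open>F\<close> is orthogonal to the kernel of \<open>L\<close>, and every point \<open>(f, T f)\<close> of the graph is \<open>L F\<close>
  for such an \<open>F\<close>. Testing against \<open>S = k(\<cdot>, y) A(y)\<^sup>*\<close> gives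
  \<open>\<langle>f, A S\<rangle> + \<langle>T f, B S\<rangle> = \<langle>F, S\<rangle> = A(y) F(y) = f(y)\<close>, which is the reproducing property of \<open>A S\<close>
  in the graph norm of \<open>T\<close>. With \<open>S = k(\<cdot>, y) B(y)\<^sup>*\<close> the same sum is \<open>(T f)(y)\<close>, so
  \<open>k(\<cdot>, y) - B S\<close> lies in the domain of \<open>T\<^sup>*\<close> and is mapped to \<open>A S\<close>; since \<open>T (A S) = B S\<close>, it
  reproduces the value at \<open>y\<close> in the graph norm of \<open>T\<^sup>*\<close>.\<close>

interpretation cvec: vector_space "scaleC :: complex \<Rightarrow> 'a \<Rightarrow> 'a::complex_vector"
  by (rule vector_space_scaleC)

section \<open>Inner product spaces\<close>

text \<open>These are the clauses of \<open>hilbert_space\<close> without completeness. The target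
  \<open>direct_sum H H\<close> of the partial isometry enters only at this level.\<close>

locale pre_hilbert =
  fixes V :: "'v::complex_vector ip_space"
  assumes subspace: "module.subspace scaleC (vecs V)"
    and ip_add_left: "\<lbrakk>f \<in> vecs V; g \<in> vecs V; w \<in> vecs V\<rbrakk> \<Longrightarrow> ip V (f + g) w = ip V f w + ip V g w"
    and ip_scale_left: "\<lbrakk>f \<in> vecs V; w \<in> vecs V\<rbrakk> \<Longrightarrow> ip V (c *\<^sub>C f) w = c * ip V f w"
    and ip_cnj: "\<lbrakk>f \<in> vecs V; g \<in> vecs V\<rbrakk> \<Longrightarrow> ip V g f = cnj (ip V f g)"
    and ip_pos: "\<lbrakk>f \<in> vecs V; f \<noteq> 0\<rbrakk> \<Longrightarrow> Re (ip V f f) > 0"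
begin

lemma zero_in [simp]: "0 \<in> vecs V"
  and add_in [simp]: "\<lbrakk>f \<in> vecs V; g \<in> vecs V\<rbrakk> \<Longrightarrow> f + g \<in> vecs V"
  and diff_in [simp]: "\<lbrakk>f \<in> vecs V; g \<in> vecs V\<rbrakk> \<Longrightarrow> f - g \<in> vecs V"
  and scale_in [simp]: "f \<in> vecs V \<Longrightarrow> c *\<^sub>C f \<in> vecs V"
  using subspace
  by (auto intro: cvec.subspace_0 cvec.subspace_add cvec.subspace_diff cvec.subspace_scale)

lemma ip_zero_left [simp]: "w \<in> vecs V \<Longrightarrow> ip V 0 w = 0"
  using ip_scale_left[of 0 w 0] by simp

lemma ip_zero_right [simp]: "w \<in> vecs V \<Longrightarrow> ip V w 0 = 0"
  using ip_cnj[of 0 w] by simp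

lemma ip_add_right:
  "\<lbrakk>f \<in> vecs V; g \<in> vecs V; w \<in> vecs V\<rbrakk> \<Longrightarrow> ip V w (f + g) = ip V w f + ip V w g"
  by (simp add: ip_cnj[of _ w] ip_add_left)

lemma ip_scale_right: "\<lbrakk>f \<in> vecs V; w \<in> vecs V\<rbrakk> \<Longrightarrow> ip V w (c *\<^sub>C f) = cnj c * ip V w f"
  by (simp add: ip_cnj[of _ w] ip_scale_left)

lemma ip_diff_left:
  "\<lbrakk>f \<in> vecs V; g \<in> vecs V; w \<in> vecs V\<rbrakk> \<Longrightarrow> ip V (f - g) w = ip V f w - ip V g w"
  using ip_add_left[of "f - g" g w] by simp

lemma ip_diff_right:
  "\<lbrakk>f \<in> vecs V; g \<in> vecs V; w \<in> vecs V\<rbrakk> \<Longrightarrow> ip V w (f - g) = ip V w f - ip V w g"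
  using ip_add_right[of "f - g" g w] by simp

lemmas ip_expand = ip_add_left ip_add_right ip_diff_left ip_diff_right ip_scale_left ip_scale_right

lemma ip_self_nonneg: "f \<in> vecs V \<Longrightarrow> Re (ip V f f) \<ge> 0"
  using ip_pos[of f] by (cases "f = 0") auto

lemma nrm_nonneg [simp]: "f \<in> vecs V \<Longrightarrow> nrm V f \<ge> 0"
  by (simp add: nrm_def ip_self_nonneg)

lemma nrm_square: "f \<in> vecs V \<Longrightarrow> (nrm V f)\<^sup>2 = Re (ip V f f)"
  by (simp add: nrm_def ip_self_nonneg)

lemma ip_self: "f \<in> vecs V \<Longrightarrow> ip V f f = of_real ((nrm V f)\<^sup>2)"
  using ip_cnj[of f f] by (simp add: nrm_square complex_eq_iff)

lemma nrm_eq_0_iff [simp]: "f \<in> vecs V \<Longrightarrow> nrm V f = 0 \<longleftrightarrow> f = 0"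
  using ip_pos[of f] by (cases "f = 0") (auto simp: nrm_def)

lemma nrm_scale: "f \<in> vecs V \<Longrightarrow> nrm V (c *\<^sub>C f) = cmod c * nrm V f"
proof -
  assume f: "f \<in> vecs V"
  then have "ip V (c *\<^sub>C f) (c *\<^sub>C f) = (c * cnj c) * ip V f f"
    by (simp add: ip_scale_left ip_scale_right)
  then have "Re (ip V (c *\<^sub>C f) (c *\<^sub>C f)) = (cmod c)\<^sup>2 * Re (ip V f f)"
    by (simp add: complex_mult_cnj cmod_power2)
  then show ?thesis
    by (simp add: nrm_def real_sqrt_mult)
qed

lemma nrm_minus_commute: "\<lbrakk>f \<in> vecs V; g \<in> vecs V\<rbrakk> \<Longrightarrow> nrm V (f - g) = nrm V (g - f)"
  using nrm_scale[of "g - f" "-1"] by simp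

text \<open>Pythagoras for removing from \<open>f\<close> its component along \<open>g\<close>.
  Nonnegativity of the left side is Cauchy-Schwarz; the strict decrease when \<open>ip V f g\<close>
  is nonzero gives orthogonality in \<open>projection\<close>.\<close>

lemma nrm_square_minus_scale:
  assumes f: "f \<in> vecs V" and g: "g \<in> vecs V" and "g \<noteq> 0"
  shows "(nrm V (f - (ip V f g / ip V g g) *\<^sub>C g))\<^sup>2
    = (nrm V f)\<^sup>2 - (cmod (ip V f g))\<^sup>2 / (nrm V g)\<^sup>2"
proof -
  define z where "z = ip V f g"
  define n where "n = (nrm V g)\<^sup>2"
  define c where "c = z / of_real n"
  have n: "n \<noteq> 0"
    using assms by (simp add: n_def)
  have gg: "ip V g g = of_real n" and gf: "ip V g f = cnj z"
    unfolding n_def z_def using ip_self ip_cnj f g by blast+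
  have cn: "c * of_real n = z" and ccnj: "cnj c = cnj z / of_real n"
    using n by (simp_all add: c_def)
  have "ip V (f - c *\<^sub>C g) (f - c *\<^sub>C g)
      = ip V f f - cnj c * z - (c * cnj z - cnj c * (c * of_real n))"
    using f g by (simp add: ip_expand gg gf z_def[symmetric] right_diff_distrib)
  also have "\<dots> = ip V f f - z * cnj z / of_real n"
    by (simp add: cn) (simp add: ccnj c_def)
  also have "\<dots> = ip V f f - of_real ((cmod z)\<^sup>2 / n)"
    by (simp only: complex_norm_square of_real_divide)
  finally have "Re (ip V (f - c *\<^sub>C g) (f - c *\<^sub>C g)) = Re (ip V f f) - (cmod z)\<^sup>2 / n"
    by simp
  then show ?thesis
    using f g by (simp add: nrm_square[of f] nrm_square[of "f - _"] gg flip: z_def n_def c_def)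
qed

lemma cauchy_schwarz:
  assumes f: "f \<in> vecs V" and g: "g \<in> vecs V"
  shows "cmod (ip V f g) \<le> nrm V f * nrm V g"
proof (cases "g = 0")
  case False
  have "0 \<le> (nrm V f)\<^sup>2 - (cmod (ip V f g))\<^sup>2 / (nrm V g)\<^sup>2"
    using nrm_square_minus_scale[OF f g False] zero_le_power2 by metis
  then have "(cmod (ip V f g))\<^sup>2 \<le> (nrm V f * nrm V g)\<^sup>2"
    using g False by (simp add: field_simps power_mult_distrib)
  then show ?thesis
    by (rule power2_le_imp_le) (use f g in simp)
qed (use f in simp)

lemma nrm_square_add:
  assumes f: "f \<in> vecs V" and g: "g \<in> vecs V"
  shows "(nrm V (f + g))\<^sup>2 = (nrm V f)\<^sup>2 + (nrm V g)\<^sup>2 + 2 * Re (ip V f g)"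
  using f g by (simp add: nrm_square ip_expand ip_cnj[of f g])

lemma nrm_square_diff:
  assumes f: "f \<in> vecs V" and g: "g \<in> vecs V"
  shows "(nrm V (f - g))\<^sup>2 = (nrm V f)\<^sup>2 + (nrm V g)\<^sup>2 - 2 * Re (ip V f g)"
  using f g by (simp add: nrm_square ip_expand ip_cnj[of f g])

lemma nrm_triangle:
  assumes f: "f \<in> vecs V" and g: "g \<in> vecs V"
  shows "nrm V (f + g) \<le> nrm V f + nrm V g"
proof -
  have "Re (ip V f g) \<le> nrm V f * nrm V g"
    using cauchy_schwarz[OF f g] complex_Re_le_cmod[of "ip V f g"] by linarith
  then have "(nrm V (f + g))\<^sup>2 \<le> (nrm V f + nrm V g)\<^sup>2"
    using nrm_square_add[OF f g] by (simp add: power2_sum)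
  then show ?thesis
    by (rule power2_le_imp_le) (use f g in simp)
qed

lemma nrm_triangle_diff:
  assumes "f \<in> vecs V" "g \<in> vecs V" "w \<in> vecs V"
  shows "nrm V (f - w) \<le> nrm V (f - g) + nrm V (g - w)"
  using nrm_triangle[of "f - g" "g - w"] assms by simp

section \<open>The norm metric and convergence of sequences\<close>

sublocale metric: Metric_space "vecs V" "hdist V"
proof
  fix x y z
  show "0 \<le> hdist V x y" "hdist V x y = hdist V y x"
    by (auto simp: hdist_def nrm_minus_commute)
  show "hdist V x y = 0 \<longleftrightarrow> x = y" if "x \<in> vecs V" "y \<in> vecs V"
    using that by (simp add: hdist_def)
  show "hdist V x z \<le> hdist V x y + hdist V y z" if "x \<in> vecs V" "y \<in> vecs V" "z \<in> vecs V"
    using that nrm_triangle_diff by (simp add: hdist_def)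
qed

lemma limitin_iff:
  assumes "\<And>n. s n \<in> vecs V" "v \<in> vecs V"
  shows "limitin (norm_topology V) s v sequentially \<longleftrightarrow> (\<lambda>n. nrm V (s n - v)) \<longlonglongrightarrow> 0"
  using assms by (simp add: norm_topology_def metric.limitin_metric_dist_null hdist_def)

lemma MCauchy_iff:
  assumes "\<And>n. s n \<in> vecs V"
  shows "metric.MCauchy s \<longleftrightarrow>
    (\<forall>e>0. \<exists>N. \<forall>n m. N \<le> n \<longrightarrow> N \<le> m \<longrightarrow> nrm V (s n - s m) < e)"
  using assms by (auto simp: metric.MCauchy_def hdist_def)

lemma tendsto_ip:
  assumes s: "\<And>n. s n \<in> vecs V" and v: "v \<in> vecs V" and w: "w \<in> vecs V"
    and lim: "(\<lambda>n. nrm V (s n - v)) \<longlonglongrightarrow> 0"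
  shows "(\<lambda>n. ip V (s n) w) \<longlonglongrightarrow> ip V v w" "(\<lambda>n. ip V w (s n)) \<longlonglongrightarrow> ip V w v"
proof -
  have "(\<lambda>n. ip V (s n) w - ip V v w) \<longlonglongrightarrow> 0"
  proof (rule tendsto_0_le[OF lim, of _ "nrm V w"], rule always_eventually, rule allI)
    fix n
    have "cmod (ip V (s n - v) w) \<le> nrm V (s n - v) * nrm V w"
      using s v w by (intro cauchy_schwarz) auto
    then show "norm (ip V (s n) w - ip V v w) \<le> norm (nrm V (s n - v)) * nrm V w"
      using s v w by (simp add: ip_diff_left)
  qed
  then show 1: "(\<lambda>n. ip V (s n) w) \<longlonglongrightarrow> ip V v w"
    by (rule LIM_zero_cancel)
  then have "(\<lambda>n. cnj (ip V (s n) w)) \<longlonglongrightarrow> cnj (ip V v w)"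
    by (rule tendsto_cnj)
  then show "(\<lambda>n. ip V w (s n)) \<longlonglongrightarrow> ip V w v"
    using s v w by (simp add: ip_cnj[of _ w])
qed

text \<open>A nonzero \<open>w\<close> would have some \<open>y\<close> in \<open>D\<close> closer
  to it than \<open>nrm V w\<close>, but orthogonality forces the squared distance to be at least
  the square of \<open>nrm V w\<close>. This makes values of the adjoint unique.\<close>

lemma dense_orthogonal_eq_0:
  assumes D: "norm_topology V closure_of D = vecs V" and "D \<subseteq> vecs V" and w: "w \<in> vecs V"
    and orth: "\<And>f. f \<in> D \<Longrightarrow> ip V f w = 0"
  shows "w = 0"
proof (rule ccontr)
  assume "w \<noteq> 0"
  then have pos: "nrm V w > 0"
    using w nrm_nonneg[of w] nrm_eq_0_iff[of w] by linarith
  have "w \<in> metric.mtopology closure_of D"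
    using w D by (simp add: norm_topology_def)
  then obtain y where y: "y \<in> D" "hdist V w y < nrm V w"
    using pos unfolding metric.metric_closure_of by auto
  have yv: "y \<in> vecs V"
    using y assms(2) by auto
  have "ip V w y = 0"
    using orth[OF y(1)] ip_cnj[OF yv w] by simp
  then have "(nrm V (w - y))\<^sup>2 \<ge> (nrm V w)\<^sup>2"
    using nrm_square_diff[OF w yv] by simp
  moreover have "nrm V (w - y) < nrm V w"
    using y w yv by (simp add: hdist_def)
  then have "(nrm V (w - y))\<^sup>2 < (nrm V w)\<^sup>2"
    by (rule power_strict_mono) (use w yv in auto)
  ultimately show False
    by simp
qed

end

section \<open>Completeness and orthogonal projection\<close>

locale hilbert = pre_hilbert +
  assumes complete: "metric.mcomplete"
begin

lemma Cauchy_converges: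
  assumes s: "\<And>n. s n \<in> vecs V"
    and cau: "\<And>e. e > 0 \<Longrightarrow> \<exists>N. \<forall>n m. N \<le> n \<longrightarrow> N \<le> m \<longrightarrow> nrm V (s n - s m) < e"
  obtains v where "v \<in> vecs V" "(\<lambda>n. nrm V (s n - v)) \<longlonglongrightarrow> 0"
proof -
  have "metric.MCauchy s"
    using MCauchy_iff s cau by blast
  then obtain v where lim: "limitin metric.mtopology s v sequentially"
    using complete unfolding metric.mcomplete_def by blast
  then have "v \<in> vecs V"
    by (rule metric.limitin_mspace)
  then show thesis
    using that lim limitin_iff[OF s] by (simp add: norm_topology_def)
qed

text \<open>A minimizing sequence for the distance to \<open>M\<close> is Cauchy by the parallelogram law.\<close>

lemma projection:
  assumes M: "module.subspace scaleC M" and MV: "M \<subseteq> vecs V" and v: "v \<in> vecs V"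
    and closed: "\<And>s w. \<lbrakk>\<And>n. s n \<in> M; w \<in> vecs V; (\<lambda>n. nrm V (s n - w)) \<longlonglongrightarrow> 0\<rbrakk> \<Longrightarrow> w \<in> M"
  obtains p where "p \<in> M" "\<And>m. m \<in> M \<Longrightarrow> ip V (v - p) m = 0"
proof -
  define d where "d = (INF m\<in>M. (nrm V (v - m))\<^sup>2)"
  have bdd: "bdd_below ((\<lambda>m. (nrm V (v - m))\<^sup>2) ` M)"
    by (rule bdd_belowI2[of _ 0]) simp
  have ne: "M \<noteq> {}"
    using cvec.subspace_0[OF M] by auto
  have d_le: "d \<le> (nrm V (v - m))\<^sup>2" if "m \<in> M" for m
    unfolding d_def using bdd that by (rule cINF_lower)
  have "\<exists>m\<in>M. (nrm V (v - m))\<^sup>2 < d + 1 / Suc n" for n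
    using cINF_less_iff[OF ne bdd, of "d + 1 / Suc n"] unfolding d_def by simp
  then obtain s where sM: "\<And>n. s n \<in> M" and sd: "\<And>n. (nrm V (v - s n))\<^sup>2 < d + 1 / Suc n"
    by metis
  have s: "s n \<in> vecs V" for n
    using sM MV by auto
  have close: "(nrm V (s n - s m))\<^sup>2 \<le> 4 / Suc N" if "N \<le> n" "N \<le> m" for n m N
  proof -
    \<comment> \<open>The midpoint \<open>?h\<close> lies in \<open>M\<close>, so the square of
      \<open>nrm V (?a + ?b)\<close> is at least \<open>4 * d\<close>. Since both squared distances
      are below \<open>d + 1 / Suc N\<close>, the parallelogram law leaves at most
      \<open>4 / Suc N\<close>.\<close>
    let ?a = "v - s n" and ?b = "v - s m"
    let ?h = "(1/2) *\<^sub>C (s n + s m)"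
    have "?h \<in> M"
      by (intro cvec.subspace_scale[OF M] cvec.subspace_add[OF M] sM)
    then have "d \<le> (nrm V (v - ?h))\<^sup>2"
      by (rule d_le)
    moreover have "?a + ?b = 2 *\<^sub>C (v - ?h)"
      using cvec.scale_left_distrib[of 1 1 v] by (simp add: cvec.scale_right_diff_distrib)
    then have "(nrm V (?a + ?b))\<^sup>2 = 4 * (nrm V (v - ?h))\<^sup>2"
      using s v by (simp add: nrm_scale power_mult_distrib)
    moreover have "(nrm V (?a - ?b))\<^sup>2 + (nrm V (?a + ?b))\<^sup>2 = 2 * (nrm V ?a)\<^sup>2 + 2 * (nrm V ?b)\<^sup>2"
      using s v nrm_square_add[of ?a ?b] nrm_square_diff[of ?a ?b] by simp
    moreover have "?a - ?b = s m - s n"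
      by simp
    moreover have "1 / real (Suc n) \<le> 1 / Suc N" "1 / real (Suc m) \<le> 1 / Suc N"
      using that by (auto intro!: divide_left_mono)
    moreover have "(nrm V ?a)\<^sup>2 < d + 1 / Suc n" "(nrm V ?b)\<^sup>2 < d + 1 / Suc m"
      using sd by auto
    ultimately show ?thesis
      using nrm_minus_commute[OF s[of m] s[of n]] by simp
  qed
  obtain p where p: "p \<in> vecs V" and lim: "(\<lambda>n. nrm V (s n - p)) \<longlonglongrightarrow> 0"
  proof (rule Cauchy_converges[OF s])
    fix e :: real
    assume e: "e > 0"
    then obtain N where N: "4 / real (Suc N) < e\<^sup>2"
      using reals_Archimedean[of "e\<^sup>2 / 4"] by (auto simp: field_simps)
    have "nrm V (s n - s m) < e" if "N \<le> n" "N \<le> m" for n m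
      by (rule power2_less_imp_less) (use close[OF that] N e in auto)
    then show "\<exists>N. \<forall>n m. N \<le> n \<longrightarrow> N \<le> m \<longrightarrow> nrm V (s n - s m) < e"
      by blast
  qed blast
  have pM: "p \<in> M"
    using closed[OF sM p lim] .
  \<comment> \<open>The infimum is attained at \<open>p\<close>: bound \<open>nrm V (v - p)\<close>
    through \<open>s n\<close>, square, and let n tend to infinity. Nonnegativity of
    \<open>d\<close> is what turns the square of \<open>sqrt d\<close> back into
    \<open>d\<close>.\<close>
  have min: "(nrm V (v - p))\<^sup>2 \<le> d"
  proof (rule LIMSEQ_le[rotated 2])
    show "\<exists>N. \<forall>n\<ge>N. (nrm V (v - p))\<^sup>2 \<le> (sqrt (d + 1 / Suc n) + nrm V (s n - p))\<^sup>2"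
    proof (intro exI allI impI power_mono)
      fix n
      have "nrm V (v - p) \<le> nrm V (v - s n) + nrm V (s n - p)"
        using nrm_triangle_diff v s p by blast
      moreover have "nrm V (v - s n) \<le> sqrt (d + 1 / Suc n)"
        using sd[of n] by (intro real_le_rsqrt) auto
      ultimately show "nrm V (v - p) \<le> sqrt (d + 1 / Suc n) + nrm V (s n - p)"
        by linarith
    qed (use v p in auto)
    have "d \<ge> 0"
      unfolding d_def using ne by (intro cINF_greatest) auto
    moreover have "(\<lambda>n. (sqrt (d + 1 / Suc n) + nrm V (s n - p))\<^sup>2) \<longlonglongrightarrow> (sqrt (d + 0) + 0)\<^sup>2"
      by (intro tendsto_intros lim LIMSEQ_Suc[OF lim_1_over_n])
    ultimately show "(\<lambda>n. (sqrt (d + 1 / Suc n) + nrm V (s n - p))\<^sup>2) \<longlonglongrightarrow> d"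
      by simp
  qed simp
  have "ip V (v - p) m = 0" if m: "m \<in> M" for m
  proof (rule ccontr)
    assume nz: "ip V (v - p) m \<noteq> 0"
    have mV: "m \<in> vecs V"
      using m MV by auto
    then have m0: "m \<noteq> 0"
      using nz v p by auto
    \<comment> \<open>Moving \<open>p\<close> by \<open>?c *\<^sub>C m\<close> removes the component
      of \<open>v - p\<close> along \<open>m\<close>, which would push the distance below the
      minimum.\<close>
    let ?c = "ip V (v - p) m / ip V m m"
    have "p + ?c *\<^sub>C m \<in> M"
      using pM m M by (simp add: cvec.subspace_add cvec.subspace_scale)
    then have "(nrm V (v - p))\<^sup>2 \<le> (nrm V (v - (p + ?c *\<^sub>C m)))\<^sup>2"
      using d_le min by force
    also have "\<dots> = (nrm V (v - p))\<^sup>2 - (cmod (ip V (v - p) m))\<^sup>2 / (nrm V m)\<^sup>2"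
      using nrm_square_minus_scale[of "v - p" m] v p mV m0 by (simp add: diff_diff_eq)
    finally show False
      using nz mV m0 by (simp add: divide_le_0_iff)
  qed
  then show thesis
    using that pM by blast
qed

end

section \<open>The complex line and direct sums\<close>

lemma hilbert_space_iff: "hilbert_space V \<longleftrightarrow> hilbert V"
  unfolding hilbert_space_def hilbert_def hilbert_axioms_def pre_hilbert_def Ball_def
  by (intro iffI conjI; elim conjE; (assumption | blast))

lemma complex_line_simps [simp]:
  "vecs complex_line = UNIV" "ip complex_line z w = z * cnj w" "nrm complex_line z = cmod z"
  by (simp_all add: complex_line_def nrm_def complex_mult_cnj cmod_def power2_eq_square)

lemma pre_hilbert_complex_line: "pre_hilbert complex_line"
proof
  show "0 < Re (ip complex_line f f)" if "f \<noteq> 0" for f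
    using that by (simp add: complex_mult_cnj complex_neq_0 flip: of_real_power)
qed (simp_all add: scaleC_complex_def algebra_simps)

lemma direct_sum_simps [simp]:
  "vecs (direct_sum V W) = vecs V \<times> vecs W"
  "ip (direct_sum V W) (a, b) (c, d) = ip V a c + ip W b d"
  by (simp_all add: direct_sum_def)

lemma pre_hilbert_direct_sum:
  assumes "pre_hilbert V" "pre_hilbert W"
  shows "pre_hilbert (direct_sum V W)"
proof -
  interpret V: pre_hilbert V by fact
  interpret W: pre_hilbert W by fact
  show ?thesis
  proof
    show "cvec.subspace (vecs (direct_sum V W))"
      by (rule cvec.subspaceI) (auto simp: scaleC_prod_def zero_prod_def)
    fix p assume p: "p \<in> vecs (direct_sum V W)" "p \<noteq> 0"
    then show "0 < Re (ip (direct_sum V W) p p)"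
      using V.ip_pos[of "fst p"] W.ip_pos[of "snd p"]
        V.ip_self_nonneg[of "fst p"] W.ip_self_nonneg[of "snd p"]
      by (cases p; cases "fst p = 0") (auto simp: zero_prod_def intro: add_pos_nonneg)
  next
    fix p q assume "p \<in> vecs (direct_sum V W)" "q \<in> vecs (direct_sum V W)"
    then show "ip (direct_sum V W) q p = cnj (ip (direct_sum V W) p q)"
      using V.ip_cnj[of "fst p" "fst q"] W.ip_cnj[of "snd p" "snd q"]
      by (cases p; cases q) auto
  qed (auto simp: scaleC_prod_def V.ip_add_left V.ip_scale_left W.ip_add_left W.ip_scale_left
      algebra_simps)
qed

section \<open>Bounded operators\<close>

lemma bounded_operator_in: "\<lbrakk>bounded_operator V W L; f \<in> vecs V\<rbrakk> \<Longrightarrow> L f \<in> vecs W"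
  and bounded_operator_add:
    "\<lbrakk>bounded_operator V W L; f \<in> vecs V; g \<in> vecs V\<rbrakk> \<Longrightarrow> L (f + g) = L f + L g"
  and bounded_operator_scale:
    "\<lbrakk>bounded_operator V W L; f \<in> vecs V\<rbrakk> \<Longrightarrow> L (c *\<^sub>C f) = c *\<^sub>C L f"
  by (auto simp: bounded_operator_def linear_operator_def everywhere_def)

context pre_hilbert
begin

lemma bounded_operator_diff:
  "\<lbrakk>bounded_operator V W L; f \<in> vecs V; g \<in> vecs V\<rbrakk> \<Longrightarrow> L (f - g) = L f - L g"
  using bounded_operator_add[of V W L "f - g" g] by simp

lemma bounded_operator_zero: "bounded_operator V W L \<Longrightarrow> L 0 = 0"
  using bounded_operator_scale[of V W L 0 0] by simp

lemma subspace_kernel: 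
  assumes L: "bounded_operator V W L"
  shows "cvec.subspace {v \<in> vecs V. L v = 0}"
  by (rule cvec.subspaceI)
    (use L in \<open>auto simp: bounded_operator_zero bounded_operator_add bounded_operator_scale\<close>)

text \<open>Since \<open>L v = L (v - s n)\<close>, the operator bound dominates
  \<open>nrm W (L v)\<close> by a null sequence. This is the closedness that
  \<open>projection\<close> asks for.\<close>

lemma bounded_operator_kernel_closed:
  assumes L: "bounded_operator V W L" and "pre_hilbert W"
    and s: "\<And>n. s n \<in> vecs V" "\<And>n. L (s n) = 0" and v: "v \<in> vecs V"
    and lim: "(\<lambda>n. nrm V (s n - v)) \<longlonglongrightarrow> 0"
  shows "L v = 0"
proof -
  interpret W: pre_hilbert W by fact
  obtain C where C: "\<And>v. v \<in> vecs V \<Longrightarrow> nrm W (L v) \<le> C * nrm V v"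
    using L by (auto simp: bounded_operator_def)
  have Lv: "L v \<in> vecs W"
    using L v by (rule bounded_operator_in)
  have "nrm W (L v) \<le> C * nrm V (s n - v)" for n
    using C[of "v - s n"] L s v by (simp add: bounded_operator_diff nrm_minus_commute)
  then have "nrm W (L v) \<le> C * 0"
    by (intro LIMSEQ_le_const[OF tendsto_mult_left[OF lim]]) auto
  then show ?thesis
    using Lv W.nrm_nonneg[OF Lv] by (simp add: order_antisym_conv)
qed

end

section \<open>Riesz representation and partial isometries\<close>

context hilbert
begin

text \<open>Here \<open>p\<close> is the projection of \<open>v\<close> to the kernel of
  \<open>L\<close>, so \<open>v - p\<close> has the same image as \<open>v\<close> and lies where a
  partial isometry preserves norms.\<close>

lemma kernel_decomposition:
  assumes L: "bounded_operator V W L" and W: "pre_hilbert W" and v: "v \<in> vecs V"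
  obtains p where "p \<in> vecs V" "L p = 0" "\<And>z. \<lbrakk>z \<in> vecs V; L z = 0\<rbrakk> \<Longrightarrow> ip V (v - p) z = 0"
proof (rule projection[OF subspace_kernel[OF L] _ v])
  show "w \<in> {v \<in> vecs V. L v = 0}"
    if "\<And>n. s n \<in> {v \<in> vecs V. L v = 0}" "w \<in> vecs V" "(\<lambda>n. nrm V (s n - w)) \<longlonglongrightarrow> 0" for s w
    using bounded_operator_kernel_closed[OF L W, of s w] that by auto
qed (use that in auto)

text \<open>The orthogonal complement of the kernel of a nonzero functional is a line; the
  representing vector is a multiple of a vector \<open>q\<close> spanning it.\<close>

lemma riesz_representation:
  assumes b: "bounded_operator V complex_line b"
  obtains w where "w \<in> vecs V" "\<And>f. f \<in> vecs V \<Longrightarrow> ip V f w = b f"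
proof (cases "\<forall>v\<in>vecs V. b v = 0")
  case True
  then show thesis
    using that[of 0] by simp
next
  case False
  then obtain v where v: "v \<in> vecs V" "b v \<noteq> 0"
    by auto
  obtain p where p: "p \<in> vecs V" "b p = 0"
    and orth: "\<And>z. \<lbrakk>z \<in> vecs V; b z = 0\<rbrakk> \<Longrightarrow> ip V (v - p) z = 0"
    using kernel_decomposition[OF b pre_hilbert_complex_line v(1)] by blast
  define q where "q = v - p"
  have q: "q \<in> vecs V" and bq: "b q \<noteq> 0"
    using v p b by (simp_all add: q_def bounded_operator_diff)
  then have "q \<noteq> 0"
    using bounded_operator_zero[OF b] by auto
  then have qq: "ip V q q \<noteq> 0"
    using q by (simp add: ip_self)
  \<comment> \<open>The conjugates in the coefficient compensate for the conjugate-linear second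
    argument. Subtracting \<open>(b f / b q) *\<^sub>C q\<close> moves \<open>f\<close> into the
    kernel, which determines \<open>ip V f q\<close>.\<close>
  have "ip V f ((cnj (b q) / cnj (ip V q q)) *\<^sub>C q) = b f" if f: "f \<in> vecs V" for f
  proof -
    let ?z = "f - (b f / b q) *\<^sub>C q"
    have z: "?z \<in> vecs V" "b ?z = 0"
      using f q bq b
      by (simp_all add: bounded_operator_diff bounded_operator_scale scaleC_complex_def)
    then have "ip V ?z q = 0"
      using orth[OF z] ip_cnj[OF q z(1)] by (simp add: q_def)
    then have "ip V f q = b f / b q * ip V q q"
      using f q by (simp add: ip_expand)
    then show ?thesis
      using f q qq bq by (simp add: ip_scale_right)
  qed
  then show thesis
    using that q by (meson scale_in)
qed

text \<open>Pairing \<open>b f\<close> with 1 in \<open>complex_line\<close> returns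
  \<open>b f\<close>, so the adjoint at 1 is the Riesz vector of \<open>b\<close>. Its uniqueness
  justifies the \<open>THE\<close> in \<open>adjoint_op\<close>.\<close>

lemma adjoint_functional:
  assumes b: "bounded_operator V complex_line b"
  defines "w \<equiv> app (adjoint_op V complex_line (everywhere V b)) 1"
  shows "w \<in> vecs V" "\<And>f. f \<in> vecs V \<Longrightarrow> ip V f w = b f"
proof -
  have "\<exists>!w. w \<in> vecs V \<and> (\<forall>f\<in>vecs V. ip complex_line (b f) 1 = ip V f w)"
  proof (rule ex_ex1I)
    show "\<exists>w. w \<in> vecs V \<and> (\<forall>f\<in>vecs V. ip complex_line (b f) 1 = ip V f w)"
      using riesz_representation[OF b] by (metis complex_line_simps(2) complex_cnj_one mult.right_neutral)
  next
    fix w w'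
    assume w: "w \<in> vecs V \<and> (\<forall>f\<in>vecs V. ip complex_line (b f) 1 = ip V f w)"
      and w': "w' \<in> vecs V \<and> (\<forall>f\<in>vecs V. ip complex_line (b f) 1 = ip V f w')"
    then have "ip V (w - w') (w - w') = 0"
      using ip_diff_right[of w w' "w - w'"] by (metis diff_in eq_iff_diff_eq_0)
    then show "w = w'"
      using w w' ip_self[of "w - w'"] by simp
  qed
  then have "w \<in> vecs V \<and> (\<forall>f\<in>vecs V. ip complex_line (b f) 1 = ip V f w)"
    unfolding w_def adjoint_op_def everywhere_def operator.select_convs by (rule theI')
  then show "w \<in> vecs V" "\<And>f. f \<in> vecs V \<Longrightarrow> ip V f w = b f"
    by simp_all
qed

text \<open>Off the kernel the inner product is recovered from the norm by polarization; the component
  of \<open>w\<close> in the kernel contributes to neither side.\<close>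

lemma partial_isometry_ip:
  assumes L: "partial_isometry V W L" and W: "pre_hilbert W"
    and v: "v \<in> vecs V" and orth: "\<And>z. \<lbrakk>z \<in> vecs V; L z = 0\<rbrakk> \<Longrightarrow> ip V v z = 0"
    and w: "w \<in> vecs V"
  shows "ip W (L v) (L w) = ip V v w"
proof -
  interpret W: pre_hilbert W by fact
  have bd: "bounded_operator V W L"
    using L by (simp add: partial_isometry_def)
  have iso: "nrm W (L f) = nrm V f"
      if "f \<in> vecs V" "\<And>z. \<lbrakk>z \<in> vecs V; L z = 0\<rbrakk> \<Longrightarrow> ip V f z = 0" for f
    using L that by (auto simp: partial_isometry_def)
  obtain p where p: "p \<in> vecs V" "L p = 0"
    and q: "\<And>z. \<lbrakk>z \<in> vecs V; L z = 0\<rbrakk> \<Longrightarrow> ip V (w - p) z = 0"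
    using kernel_decomposition[OF bd W w] by blast
  define q where "q = w - p"
  have qV: "q \<in> vecs V" and Lq: "L q = L w" and vq: "ip V v q = ip V v w"
    using w p v orth bd by (simp_all add: q_def bounded_operator_diff ip_diff_right)
  have Lin: "L v \<in> vecs W" "L q \<in> vecs W"
    using bounded_operator_in[OF bd] v qV by auto
  \<comment> \<open>Vectors orthogonal to the kernel form a subspace, so \<open>L\<close> preserves
    the norms of \<open>v\<close>, \<open>c *\<^sub>C q\<close> and their sum. Expanding the norm of
    the sum isolates the real part.\<close>
  have re: "Re (ip W (L v) (c *\<^sub>C L q)) = Re (ip V v (c *\<^sub>C q))" for c
  proof -
    have cq: "nrm W (L (c *\<^sub>C q)) = nrm V (c *\<^sub>C q)" "nrm W (L v) = nrm V v"
      "nrm W (L (v + c *\<^sub>C q)) = nrm V (v + c *\<^sub>C q)"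
      using v qV orth q by (auto intro!: iso simp: ip_scale_left ip_add_left q_def[symmetric])
    moreover have "L (v + c *\<^sub>C q) = L v + c *\<^sub>C L q" "L (c *\<^sub>C q) = c *\<^sub>C L q"
      using bd v qV by (simp_all add: bounded_operator_add bounded_operator_scale)
    ultimately show ?thesis
      using nrm_square_add[of v "c *\<^sub>C q"] W.nrm_square_add[of "L v" "c *\<^sub>C L q"] v qV Lin
      by simp
  qed
  \<comment> \<open>The choice \<open>c = 1\<close> compares real parts; \<open>c = \<i>\<close>
    compares imaginary parts.\<close>
  have "ip W (L v) (L q) = ip V v q"
    using re[of 1] re[of \<i>] v qV Lin
    by (simp add: W.ip_scale_right ip_scale_right complex_eq_iff)
  then show ?thesis
    by (simp add: Lq vq)
qed

end

section \<open>Graph norms\<close>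

lemma graph_space_simps [simp]:
  "vecs (graph_space V T) = dom_of T"
  "ip (graph_space V T) f g = ip V f g + ip V (app T f) (app T g)"
  by (simp_all add: graph_space_def)

lemma linear_operator_in: "\<lbrakk>linear_operator V W T; f \<in> dom_of T\<rbrakk> \<Longrightarrow> f \<in> vecs V"
  and linear_operator_app_in: "\<lbrakk>linear_operator V W T; f \<in> dom_of T\<rbrakk> \<Longrightarrow> app T f \<in> vecs W"
  by (auto simp: linear_operator_def)

lemma linear_operator_diff:
  assumes "linear_operator V W T" "f \<in> dom_of T" "g \<in> dom_of T"
  shows "app T (f - g) = app T f - app T g"
proof -
  have "app T (f - g + g) = app T (f - g) + app T g"
    using assms cvec.subspace_diff[of "dom_of T" f g] unfolding linear_operator_def by blast
  then show ?thesis
    by simp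
qed

context pre_hilbert
begin

lemma pre_hilbert_graph_space:
  assumes T: "linear_operator V V T"
  shows "pre_hilbert (graph_space V T)"
proof
  have dom: "f \<in> vecs V" "app T f \<in> vecs V" if "f \<in> dom_of T" for f
    using T that by (auto simp: linear_operator_def)
  show "cvec.subspace (vecs (graph_space V T))"
    using T by (simp add: linear_operator_def)
  show "ip (graph_space V T) g f = cnj (ip (graph_space V T) f g)"
    if "f \<in> vecs (graph_space V T)" "g \<in> vecs (graph_space V T)" for f g
    using that dom by (simp add: ip_cnj[of f] ip_cnj[of "app T f"])
  show "0 < Re (ip (graph_space V T) f f)"
    if "f \<in> vecs (graph_space V T)" "f \<noteq> 0" for f
    using that dom ip_pos[of f] ip_self_nonneg[of "app T f"] by (auto intro: add_pos_nonneg)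
  show "ip (graph_space V T) (f + g) w = ip (graph_space V T) f w + ip (graph_space V T) g w"
    if "f \<in> vecs (graph_space V T)" "g \<in> vecs (graph_space V T)" "w \<in> vecs (graph_space V T)"
    for f g w
    using that T dom by (simp add: linear_operator_def ip_add_left)
  show "ip (graph_space V T) (c *\<^sub>C f) w = c * ip (graph_space V T) f w"
    if "f \<in> vecs (graph_space V T)" "w \<in> vecs (graph_space V T)" for c f w
    using that T dom by (simp add: linear_operator_def ip_scale_left distrib_left)
qed

text \<open>The first two bounds make a graph-Cauchy sequence Cauchy in both components; the third
  turns componentwise convergence back into graph convergence.\<close>

lemma nrm_le_graph_nrm:
  assumes T: "linear_operator V V T" and f: "f \<in> dom_of T"
  shows "nrm V f \<le> nrm (graph_space V T) f" "nrm V (app T f) \<le> nrm (graph_space V T) f"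
    and "nrm (graph_space V T) f \<le> nrm V f + nrm V (app T f)"
proof -
  have "f \<in> vecs V" "app T f \<in> vecs V"
    using T f by (auto simp: linear_operator_def)
  then have "nrm (graph_space V T) f = sqrt ((nrm V f)\<^sup>2 + (nrm V (app T f))\<^sup>2)"
    by (simp add: nrm_square) (simp add: nrm_def)
  then show "nrm V f \<le> nrm (graph_space V T) f" "nrm V (app T f) \<le> nrm (graph_space V T) f"
    "nrm (graph_space V T) f \<le> nrm V f + nrm V (app T f)"
    using \<open>f \<in> vecs V\<close> \<open>app T f \<in> vecs V\<close> by (simp_all add: sqrt_sum_squares_le_sum)
qed

end

text \<open>A common form of closedness: for \<open>T\<close> it comes from the topology of the
  direct sum, for the adjoint from the adjoint identity. Both then share one completeness
  proof.\<close>

definition sequentially_closed :: "'v::complex_vector ip_space \<Rightarrow> ('v, 'v) operator \<Rightarrow> bool" where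
  "sequentially_closed V T \<longleftrightarrow>
     (\<forall>s f g. range s \<subseteq> dom_of T \<longrightarrow> f \<in> vecs V \<longrightarrow> g \<in> vecs V \<longrightarrow>
        (\<lambda>n. nrm V (s n - f)) \<longlonglongrightarrow> 0 \<longrightarrow> (\<lambda>n. nrm V (app T (s n) - g)) \<longlonglongrightarrow> 0 \<longrightarrow>
        f \<in> dom_of T \<and> app T f = g)"

text \<open>The components of a graph-Cauchy sequence converge in \<open>V\<close> to some
  \<open>f\<close> and \<open>g\<close>. Closedness gives \<open>app T f = g\<close>, so
  \<open>f\<close> is the limit in the graph norm.\<close>

lemma (in hilbert) hilbert_graph_space:
  assumes T: "linear_operator V V T" and closed: "sequentially_closed V T"
  shows "hilbert (graph_space V T)"
proof -
  let ?G = "graph_space V T"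
  interpret G: pre_hilbert ?G
    using T by (rule pre_hilbert_graph_space)
  show ?thesis
  proof
    show "G.metric.mcomplete"
      unfolding G.metric.mcomplete_def
    proof (intro allI impI)
      fix s assume cau: "G.metric.MCauchy s"
      then have s: "s n \<in> dom_of T" for n
        unfolding G.metric.MCauchy_def by auto
      have sV: "s n \<in> vecs V" and TsV: "app T (s n) \<in> vecs V" for n
        using T s linear_operator_in linear_operator_app_in by blast+
      have d: "f - g \<in> dom_of T" if "f \<in> dom_of T" "g \<in> dom_of T" for f g
        using G.diff_in that by simp
      have *: "\<exists>N. \<forall>n m. N \<le> n \<longrightarrow> N \<le> m \<longrightarrow> nrm ?G (s n - s m) < e" if "e > 0" for e
        using cau G.MCauchy_iff[of s] s that by auto
      have le: "nrm V (s n - s m) \<le> nrm ?G (s n - s m)"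
        "nrm V (app T (s n) - app T (s m)) \<le> nrm ?G (s n - s m)" for n m
        using nrm_le_graph_nrm[OF T d[OF s s], of n m] linear_operator_diff[OF T s s, of n m] by auto
      have cau': "\<exists>N. \<forall>n m. N \<le> n \<longrightarrow> N \<le> m \<longrightarrow> nrm V (s n - s m) < e"
        "\<exists>N. \<forall>n m. N \<le> n \<longrightarrow> N \<le> m \<longrightarrow> nrm V (app T (s n) - app T (s m)) < e" if "e > 0" for e
        using *[OF that] le order_le_less_trans by meson+
      obtain f where f: "f \<in> vecs V" "(\<lambda>n. nrm V (s n - f)) \<longlonglongrightarrow> 0"
        by (rule Cauchy_converges[where s = s, OF sV]) (use cau' in blast)+
      obtain g where g: "g \<in> vecs V" "(\<lambda>n. nrm V (app T (s n) - g)) \<longlonglongrightarrow> 0"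
        by (rule Cauchy_converges[where s = "\<lambda>n. app T (s n)", OF TsV]) (use cau' in blast)+
      have fg: "f \<in> dom_of T" "app T f = g"
        using closed s f g by (auto simp: sequentially_closed_def image_subset_iff)
      have "(\<lambda>n. nrm ?G (s n - f)) \<longlonglongrightarrow> 0"
      proof (rule tendsto_sandwich[OF _ _ tendsto_const tendsto_add_zero[OF f(2) g(2)]])
        show "\<forall>\<^sub>F n in sequentially. 0 \<le> nrm ?G (s n - f)"
          using d s fg by (auto intro!: always_eventually)
        show "\<forall>\<^sub>F n in sequentially. nrm ?G (s n - f) \<le> nrm V (s n - f) + nrm V (app T (s n) - g)"
          using nrm_le_graph_nrm(3)[OF T d[OF s fg(1)]] linear_operator_diff[OF T s fg(1)] fg(2)
          by (auto intro!: always_eventually)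
      qed
      then show "\<exists>f. limitin G.metric.mtopology s f sequentially"
        using G.limitin_iff[of s f] s fg by (auto simp: norm_topology_def)
    qed
  qed
qed

text \<open>Closedness gives completeness, and point evaluations stay bounded because the graph norm
  dominates the norm of \<open>H\<close>.\<close>

lemma rkhs_graph_space:
  assumes H: "rkhs H" and T: "linear_operator H H T" and closed: "sequentially_closed H T"
  shows "rkhs (graph_space H T)"
proof -
  interpret H: hilbert H
    using H by (simp add: rkhs_def hilbert_space_iff)
  interpret G: hilbert "graph_space H T"
    using T closed by (rule H.hilbert_graph_space)
  have "bounded_operator (graph_space H T) complex_line (\<lambda>f. f x)" for x
  proof -
    obtain C where C: "\<And>f. f \<in> vecs H \<Longrightarrow> cmod (f x) \<le> C * nrm H f"
      using H by (fastforce simp: rkhs_def bounded_operator_def)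
    \<comment> \<open>The sign of \<open>C\<close> is unknown, and enlarging the norm preserves the
      bound only for a nonnegative constant.\<close>
    have "cmod (f x) \<le> \<bar>C\<bar> * nrm (graph_space H T) f" if f: "f \<in> dom_of T" for f
    proof -
      have "f \<in> vecs H"
        using T f by (rule linear_operator_in)
      then have "cmod (f x) \<le> C * nrm H f" and "0 \<le> nrm H f"
        using C by auto
      then have "cmod (f x) \<le> \<bar>C\<bar> * nrm H f"
        by (meson abs_ge_self mult_right_mono order_trans)
      also have "\<dots> \<le> \<bar>C\<bar> * nrm (graph_space H T) f"
        using H.nrm_le_graph_nrm(1)[OF T f] by (simp add: mult_left_mono)
      finally show ?thesis .
    qed
    then show ?thesis
      using G.subspace
      by (auto simp: bounded_operator_def linear_operator_def everywhere_def scaleC_fun_def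
          scaleC_complex_def)
  qed
  then show ?thesis
    using G.hilbert_axioms G.pre_hilbert_axioms by (simp add: rkhs_def hilbert_space_iff hilbert_def)
qed

text \<open>The norm of a direct sum is the root of the sum of squares, so componentwise limits are
  limits of points of the graph.\<close>

lemma (in pre_hilbert) closed_operator_imp_sequentially_closed:
  assumes T: "linear_operator V V T" and closed: "closed_operator V V T"
  shows "sequentially_closed V T"
  unfolding sequentially_closed_def
proof (intro allI impI)
  fix s f g
  assume s: "range s \<subseteq> dom_of T" and f: "f \<in> vecs V" and g: "g \<in> vecs V"
    and lim: "(\<lambda>n. nrm V (s n - f)) \<longlonglongrightarrow> 0" "(\<lambda>n. nrm V (app T (s n) - g)) \<longlonglongrightarrow> 0"
  interpret S: pre_hilbert "direct_sum V V"
    by (intro pre_hilbert_direct_sum pre_hilbert_axioms)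
  let ?p = "\<lambda>n. (s n, app T (s n))"
  have sV: "s n \<in> vecs V" "app T (s n) \<in> vecs V" for n
    using T s by (auto simp: linear_operator_def)
  have "nrm (direct_sum V V) (?p n - (f, g))
      = sqrt ((nrm V (s n - f))\<^sup>2 + (nrm V (app T (s n) - g))\<^sup>2)" for n
    using sV f g by (simp add: nrm_square) (simp add: nrm_def)
  moreover have "(\<lambda>n. sqrt ((nrm V (s n - f))\<^sup>2 + (nrm V (app T (s n) - g))\<^sup>2)) \<longlonglongrightarrow> sqrt (0\<^sup>2 + 0\<^sup>2)"
    by (intro tendsto_intros lim)
  ultimately have "limitin (norm_topology (direct_sum V V)) ?p (f, g) sequentially"
    using S.limitin_iff[of ?p "(f, g)"] sV f g by simp
  moreover have "range ?p \<subseteq> graph T"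
    using s by (auto simp: graph_def)
  ultimately have "(f, g) \<in> graph T"
    using closed unfolding closed_operator_def norm_topology_def
      S.metric.metric_closedin_iff_sequentially_closed by blast
  then show "f \<in> dom_of T \<and> app T f = g"
    by (auto simp: graph_def)
qed

section \<open>The adjoint of a densely defined operator\<close>

locale densely_defined_operator = pre_hilbert +
  fixes T
  assumes linear: "linear_operator V V T" and dense: "densely_defined V T"
begin

abbreviation T_adj ("T\<^sup>*") where "T\<^sup>* \<equiv> adjoint_op V V T"

text \<open>One test yields both membership in the domain and the value. Two candidate values differ
  by a vector orthogonal to the dense domain, hence agree.\<close>

lemma adjoint_unique:
  assumes g: "g \<in> vecs V" and w: "w \<in> vecs V"
    and eq: "\<And>f. f \<in> dom_of T \<Longrightarrow> ip V (app T f) g = ip V f w"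
  shows "g \<in> dom_of T\<^sup>*" "app T\<^sup>* g = w"
proof -
  show "g \<in> dom_of T\<^sup>*"
    using assms by (auto simp: adjoint_op_def)
  have "v = w" if v: "v \<in> vecs V" "\<forall>f\<in>dom_of T. ip V (app T f) g = ip V f v" for v
  proof -
    have "v - w = 0"
    proof (rule dense_orthogonal_eq_0)
      show "norm_topology V closure_of dom_of T = vecs V"
        using dense by (simp add: densely_defined_def)
      show "dom_of T \<subseteq> vecs V"
        using linear by (simp add: linear_operator_def)
      show "ip V f (v - w) = 0" if "f \<in> dom_of T" for f
        using that v eq w linear_operator_in[OF linear] by (simp add: ip_diff_right)
    qed (use v w in simp)
    then show ?thesis by simp
  qed
  then show "app T\<^sup>* g = w"
    using w eq by (auto simp: adjoint_op_def intro!: the_equality)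
qed

lemma adjoint_in: "g \<in> dom_of T\<^sup>* \<Longrightarrow> g \<in> vecs V"
  by (simp add: adjoint_op_def)

lemma adjoint:
  assumes "g \<in> dom_of T\<^sup>*"
  shows "app T\<^sup>* g \<in> vecs V" "\<And>f. f \<in> dom_of T \<Longrightarrow> ip V (app T f) g = ip V f (app T\<^sup>* g)"
proof -
  obtain w where w: "g \<in> vecs V" "w \<in> vecs V"
    "\<And>f. f \<in> dom_of T \<Longrightarrow> ip V (app T f) g = ip V f w"
    using assms by (auto simp: adjoint_op_def)
  from adjoint_unique(2)[OF this] w
  show "app T\<^sup>* g \<in> vecs V" "\<And>f. f \<in> dom_of T \<Longrightarrow> ip V (app T f) g = ip V f (app T\<^sup>* g)"
    by simp_all
qed

lemma linear_operator_adjoint: "linear_operator V V T\<^sup>*"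
proof -
  note T = linear_operator_in[OF linear] linear_operator_app_in[OF linear]
  have add: "f + g \<in> dom_of T\<^sup>*" "app T\<^sup>* (f + g) = app T\<^sup>* f + app T\<^sup>* g"
    if "f \<in> dom_of T\<^sup>*" "g \<in> dom_of T\<^sup>*" for f g
    using that adjoint_in adjoint T
    by (auto intro!: adjoint_unique(1)[of _ "app T\<^sup>* f + app T\<^sup>* g"] adjoint_unique(2) simp: ip_add_right)
  have scale: "c *\<^sub>C f \<in> dom_of T\<^sup>*" "app T\<^sup>* (c *\<^sub>C f) = c *\<^sub>C app T\<^sup>* f"
    if "f \<in> dom_of T\<^sup>*" for c f
    using that adjoint_in adjoint T
    by (auto intro!: adjoint_unique(1)[of _ "c *\<^sub>C app T\<^sup>* f"] adjoint_unique(2) simp: ip_scale_right)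
  have "0 \<in> dom_of T\<^sup>*"
    by (rule adjoint_unique(1)[of 0 0]) (use T in auto)
  then have "cvec.subspace (dom_of T\<^sup>*)"
    using add scale by (intro cvec.subspaceI)
  then show ?thesis
    using add scale adjoint_in adjoint by (auto simp: linear_operator_def)
qed

text \<open>For fixed \<open>f\<close> in the domain of \<open>T\<close>, both sides of the adjoint
  identity are continuous in the adjoint's graph, so the identity survives the limit.\<close>

lemma sequentially_closed_adjoint: "sequentially_closed V T\<^sup>*"
  unfolding sequentially_closed_def
proof (intro allI impI)
  fix s g w
  assume "range s \<subseteq> dom_of T\<^sup>*" and g: "g \<in> vecs V" and w: "w \<in> vecs V"
    and lim: "(\<lambda>n. nrm V (s n - g)) \<longlonglongrightarrow> 0" "(\<lambda>n. nrm V (app T\<^sup>* (s n) - w)) \<longlonglongrightarrow> 0"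
  then have s: "s n \<in> dom_of T\<^sup>*" for n
    by auto
  have "ip V (app T f) g = ip V f w" if f: "f \<in> dom_of T" for f
  proof (rule LIMSEQ_unique)
    show "(\<lambda>n. ip V (app T f) (s n)) \<longlonglongrightarrow> ip V (app T f) g"
      using adjoint_in[OF s] g lim(1) linear_operator_app_in[OF linear f] by (intro tendsto_ip(2))
    have "(\<lambda>n. ip V f (app T\<^sup>* (s n))) \<longlonglongrightarrow> ip V f w"
      using adjoint(1)[OF s] w lim(2) linear_operator_in[OF linear f] by (intro tendsto_ip(2))
    then show "(\<lambda>n. ip V (app T f) (s n)) \<longlonglongrightarrow> ip V f w"
      using adjoint(2)[OF s f] by simp
  qed
  then show "g \<in> dom_of T\<^sup>* \<and> app T\<^sup>* g = w"
    using adjoint_unique g w by blast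
qed

end

section \<open>Kernels from a Beurling pair\<close>

locale beurling_setting =
  fixes k :: "'x \<Rightarrow> 'x \<Rightarrow> complex"
    and H :: "('x \<Rightarrow> complex) ip_space"
    and T :: "('x \<Rightarrow> complex, 'x \<Rightarrow> complex) operator"
    and E :: "('e::complex_vector) ip_space"
    and HE :: "('x \<Rightarrow> 'e) ip_space"
    and A B :: "'x \<Rightarrow> 'e \<Rightarrow> complex"
  assumes rkhs: "rkhs H" and kernel: "reproducing_kernel H k"
    and linear: "linear_operator H H T" and dense: "densely_defined H T"
    and hilbert_E: "hilbert_space E" and tensor: "tensor_rkhs k E HE"
    and beurling: "beurling_pair H E HE T A B"
begin

sublocale H: hilbert H
  using rkhs by (simp add: rkhs_def hilbert_space_iff)

sublocale H: densely_defined_operator H T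
  by unfold_locales (rule linear, rule dense)

sublocale E: hilbert E
  using hilbert_E by (simp add: hilbert_space_iff)

sublocale HE: hilbert HE
  using tensor by (simp add: tensor_rkhs_def hilbert_space_iff)

sublocale HH: pre_hilbert "direct_sum H H"
  by (intro pre_hilbert_direct_sum H.pre_hilbert_axioms)

lemma kernel_in: "(\<lambda>x. k x y) \<in> vecs H"
  and kernel_ip: "f \<in> vecs H \<Longrightarrow> ip H f (\<lambda>x. k x y) = f y"
  using kernel by (auto simp: reproducing_kernel_def)

lemma beurling_bounded: "bounded_operator E complex_line (A x)" "bounded_operator E complex_line (B x)"
  using beurling by (auto simp: beurling_pair_def row_multiplier_def)

text \<open>This is the Riesz vector of \<open>b\<close>, written exactly as in
  \<open>comp_adjoint\<close>, so that \<open>a (adj b)\<close> is the scalar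
  \<open>comp_adjoint E a b\<close>.\<close>

definition adj :: "('e \<Rightarrow> complex) \<Rightarrow> 'e" where
  "adj b = app (adjoint_op E complex_line (everywhere E b)) 1"

text \<open>The vector of \<open>HE\<close> that represents the functional sending \<open>F\<close>
  to \<open>b (F y)\<close>.\<close>

definition kernel_section :: "('e \<Rightarrow> complex) \<Rightarrow> 'x \<Rightarrow> 'x \<Rightarrow> 'e" where
  "kernel_section b y = (\<lambda>x. k x y *\<^sub>C adj b)"

lemma adj:
  assumes "bounded_operator E complex_line b"
  shows "adj b \<in> vecs E" "e \<in> vecs E \<Longrightarrow> ip E e (adj b) = b e"
  unfolding adj_def using E.adjoint_functional[OF assms] by auto

lemma kernel_section_in:
  assumes "bounded_operator E complex_line b"
  shows "kernel_section b y \<in> vecs HE"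
  using tensor adj(1)[OF assms] by (simp add: tensor_rkhs_def kernel_section_def)

lemma ip_kernel_section:
  assumes b: "bounded_operator E complex_line b" and F: "F \<in> vecs HE"
  shows "ip HE F (kernel_section b y) = b (F y)"
proof -
  have "F y \<in> vecs E"
    using tensor F bounded_operator_in[of HE E "\<lambda>F. F y"] by (simp add: tensor_rkhs_def)
  then show ?thesis
    using tensor F adj[OF b] by (simp add: tensor_rkhs_def kernel_section_def)
qed

text \<open>Linearity of \<open>C x\<close> pulls out the scalar \<open>k x y\<close>. This is the
  source of the products in both kernels.\<close>

lemma row_mult_op_kernel_section:
  assumes b: "bounded_operator E complex_line b"
    and C: "\<And>x. bounded_operator E complex_line (C x)"
  shows "row_mult_op C (kernel_section b y) = (\<lambda>x. comp_adjoint E (C x) b * k x y)"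
proof
  fix x
  have "C x (k x y *\<^sub>C adj b) = k x y *\<^sub>C C x (adj b)"
    using C adj(1)[OF b] by (rule bounded_operator_scale)
  then show "row_mult_op C (kernel_section b y) x = comp_adjoint E (C x) b * k x y"
    by (simp add: row_mult_op_def kernel_section_def comp_adjoint_def adj_def scaleC_complex_def)
qed

lemma beurling_range:
  assumes "F \<in> vecs HE"
  shows "row_mult_op A F \<in> dom_of T" "app T (row_mult_op A F) = row_mult_op B F"
proof -
  have "(row_mult_op A F, row_mult_op B F) \<in> graph T"
    using beurling assms by (auto simp: beurling_pair_def)
  then show "row_mult_op A F \<in> dom_of T" "app T (row_mult_op A F) = row_mult_op B F"
    by (auto simp: graph_def)
qed

text \<open>Each point of the graph is the image of some \<open>F\<close> orthogonal to the kernel of the partial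
  isometry; this \<open>F\<close> pairs with kernel sections as its image does.\<close>

lemma graph_ip_kernel_section:
  assumes f: "f \<in> dom_of T"
  obtains F where "F \<in> vecs HE" "f = row_mult_op A F" "app T f = row_mult_op B F"
    "\<And>b y. bounded_operator E complex_line b \<Longrightarrow>
       ip H f (row_mult_op A (kernel_section b y))
         + ip H (app T f) (row_mult_op B (kernel_section b y)) = b (F y)"
proof -
  define L where "L = (\<lambda>F. (row_mult_op A F, row_mult_op B F))"
  have L: "partial_isometry HE (direct_sum H H) L"
    using beurling by (simp add: beurling_pair_def L_def)
  then have bd: "bounded_operator HE (direct_sum H H) L"
    by (simp add: partial_isometry_def)
  have "(f, app T f) \<in> L ` vecs HE"
    using beurling f by (auto simp: beurling_pair_def L_def graph_def)
  then obtain G where G: "G \<in> vecs HE" "L G = (f, app T f)"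
    by auto
  obtain P where P: "P \<in> vecs HE" "L P = 0"
    and orth: "\<And>Z. \<lbrakk>Z \<in> vecs HE; L Z = 0\<rbrakk> \<Longrightarrow> ip HE (G - P) Z = 0"
    using HE.kernel_decomposition[OF bd HH.pre_hilbert_axioms G(1)] by blast
  have F: "G - P \<in> vecs HE" and LF: "L (G - P) = (f, app T f)"
    using G P bd by (simp_all add: HE.bounded_operator_diff)
  show thesis
  proof (rule that[OF F])
    show "f = row_mult_op A (G - P)" "app T f = row_mult_op B (G - P)"
      using LF by (simp_all add: L_def)
    fix b y
    assume b: "bounded_operator E complex_line b"
    have "ip (direct_sum H H) (L (G - P)) (L (kernel_section b y)) = ip HE (G - P) (kernel_section b y)"
      using HE.partial_isometry_ip[OF L HH.pre_hilbert_axioms F orth kernel_section_in[OF b]] by blast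
    then show "ip H f (row_mult_op A (kernel_section b y))
        + ip H (app T f) (row_mult_op B (kernel_section b y)) = b ((G - P) y)"
      using ip_kernel_section[OF b F] by (simp add: LF) (simp add: L_def)
  qed
qed

section \<open>The two reproducing kernels\<close>

lemma reproducing_kernel_dom:
  "reproducing_kernel (graph_space H T) (\<lambda>x y. comp_adjoint E (A x) (A y) * k x y)"
  unfolding reproducing_kernel_def
proof (intro allI conjI ballI)
  fix y
  note A = beurling_bounded(1)
  have eq: "(\<lambda>x. comp_adjoint E (A x) (A y) * k x y) = row_mult_op A (kernel_section (A y) y)"
    using row_mult_op_kernel_section[where C = A and b = "A y"] A by simp
  show "(\<lambda>x. comp_adjoint E (A x) (A y) * k x y) \<in> vecs (graph_space H T)"
    using beurling_range(1)[OF kernel_section_in[OF A]] by (simp add: eq)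
  fix f
  assume "f \<in> vecs (graph_space H T)"
  \<comment> \<open>With \<open>b = A y\<close> the right-hand side \<open>b (F y)\<close> is the
    value at \<open>y\<close> of \<open>row_mult_op A F\<close>, that is, of
    \<open>f\<close>.\<close>
  then obtain F where F: "f = row_mult_op A F"
    "ip H f (row_mult_op A (kernel_section (A y) y)) + ip H (app T f) (row_mult_op B (kernel_section (A y) y)) = A y (F y)"
    using graph_ip_kernel_section[of f] A by (metis graph_space_simps(1))
  then show "ip (graph_space H T) f (\<lambda>x. comp_adjoint E (A x) (A y) * k x y) = f y"
    using beurling_range(2)[OF kernel_section_in[OF A]] by (simp add: eq) (simp add: row_mult_op_def)
qed

text \<open>The kernel at \<open>y\<close> is \<open>g = k(\<cdot>, y) - B (kernel_section (B y) y)\<close>, with \<open>T\<^sup>* g = A (kernel_section (B y) y)\<close>.\<close>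

lemma reproducing_kernel_adjoint:
  "reproducing_kernel (graph_space H (adjoint_op H H T))
     (\<lambda>x y. (1 - comp_adjoint E (B x) (B y)) * k x y)"
  unfolding reproducing_kernel_def
proof (intro allI conjI ballI)
  fix y
  note B = beurling_bounded(2)
  let ?a = "row_mult_op A (kernel_section (B y) y)" and ?b = "row_mult_op B (kernel_section (B y) y)"
  let ?k = "\<lambda>x. k x y"
  let ?g = "\<lambda>x. (1 - comp_adjoint E (B x) (B y)) * k x y"
  have eq: "?g = ?k - ?b"
    using row_mult_op_kernel_section[where C = B and b = "B y"] B by (simp add: fun_eq_iff algebra_simps)
  have a: "?a \<in> dom_of T" and Ta: "app T ?a = ?b"
    using beurling_range[OF kernel_section_in[OF B]] by auto
  then have aH: "?a \<in> vecs H" and bH: "?b \<in> vecs H"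
    using linear_operator_in[OF linear a] linear_operator_app_in[OF linear a] by auto
  have g: "?g \<in> vecs H"
    using kernel_in bH by (simp add: eq)
  \<comment> \<open>Both \<open>ip H (app T f) ?k\<close> and
    \<open>ip H f ?a + ip H (app T f) ?b\<close> equal \<open>B y (F y)\<close>; subtracting the
    \<open>?b\<close> term leaves the adjoint identity for \<open>?g\<close>.\<close>
  have "ip H (app T f) ?g = ip H f ?a" if f: "f \<in> dom_of T" for f
  proof -
    obtain F where F: "app T f = row_mult_op B F"
      "ip H f ?a + ip H (app T f) ?b = B y (F y)"
      using graph_ip_kernel_section[OF f] B by metis
    have "ip H (app T f) ?k = B y (F y)"
      using kernel_ip[OF linear_operator_app_in[OF linear f]] F(1) by (simp add: row_mult_op_def)
    then show ?thesis
      using F(2) kernel_in bH linear_operator_app_in[OF linear f]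
      unfolding eq by (simp add: H.ip_diff_right diff_eq_eq)
  qed
  from H.adjoint_unique[OF g aH this]
  have g_dom: "?g \<in> dom_of (adjoint_op H H T)" and Tg: "app (adjoint_op H H T) ?g = ?a"
    by auto
  show "?g \<in> vecs (graph_space H (adjoint_op H H T))"
    using g_dom by simp
  fix f
  assume "f \<in> vecs (graph_space H (adjoint_op H H T))"
  then have f: "f \<in> dom_of (adjoint_op H H T)"
    by simp
  note fH = H.adjoint_in[OF f] H.adjoint(1)[OF f]
  \<comment> \<open>Since \<open>app T ?a = ?b\<close>, the adjoint identity makes the contributions
    of \<open>?a\<close> and \<open>?b\<close> cancel, leaving only the pairing of \<open>f\<close>
    with \<open>?k\<close>.\<close>
  have "ip H (app (adjoint_op H H T) f) ?a = ip H f ?b"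
    using H.adjoint(2)[OF f a] H.ip_cnj[OF aH fH(2)] H.ip_cnj[OF bH fH(1)] by (simp add: Ta)
  then have "ip H f (?k - ?b) + ip H (app (adjoint_op H H T) f) ?a = f y"
    using fH kernel_in bH by (simp add: H.ip_diff_right kernel_ip)
  then show "ip (graph_space H (adjoint_op H H T)) f ?g = f y"
    unfolding graph_space_simps eq Tg[unfolded eq] .
qed

end

theorem theorem3p1:
  fixes u :: "'x \<Rightarrow> 'i \<Rightarrow> complex"
    and k :: "'x \<Rightarrow> 'x \<Rightarrow> complex"
    and H :: "('x \<Rightarrow> complex) ip_space"
    and T :: "('x \<Rightarrow> complex, 'x \<Rightarrow> complex) operator"
    and h :: "'x \<Rightarrow> complex"
    and E :: "('e::complex_vector) ip_space"
    and HE :: "('x \<Rightarrow> 'e) ip_space"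
    and A B :: "'x \<Rightarrow> 'e \<Rightarrow> complex"
  assumes "cnp_space u k H"
    and "affiliated H T"
    and "closed_operator H H T"
    and "symbol_of T h"
    and "hilbert_space E"
    and "tensor_rkhs k E HE"
    and "beurling_pair H E HE T A B"
  shows "rkhs (graph_space H T) \<and>
         reproducing_kernel (graph_space H T)
           (\<lambda>x y. comp_adjoint E (A x) (A y) * k x y) \<and>
         rkhs (graph_space H (adjoint_op H H T)) \<and>
         reproducing_kernel (graph_space H (adjoint_op H H T))
           (\<lambda>x y. (1 - comp_adjoint E (B x) (B y)) * k x y)"
proof -
  have "rkhs H" "reproducing_kernel H k" "linear_operator H H T" "densely_defined H T"
    using assms by (auto simp: cnp_space_def affiliated_def)
  then interpret beurling_setting k H T E HE A B
    using assms by unfold_locales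
  \<comment> \<open>This supplies completeness of the domain of \<open>T\<close>; for the adjoint it
    comes from \<open>H.sequentially_closed_adjoint\<close>.\<close>
  have "sequentially_closed H T"
    using linear \<open>closed_operator H H T\<close> by (rule H.closed_operator_imp_sequentially_closed)
  then show ?thesis
    using rkhs_graph_space[OF rkhs linear]
      rkhs_graph_space[OF rkhs H.linear_operator_adjoint H.sequentially_closed_adjoint]
      reproducing_kernel_dom reproducing_kernel_adjoint by blast
qed

end
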